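(* Assume that the graph Laplacian $\mathbf{L}$ has precisely $r\le n$ distinct eigenvalues. Then $\mathcal{A}_{\mathbf{L}}$ is an $r$-dimensional subalgebra of the algebra $(\mathcal{L}(G),+,\ast)$. A signal $x\in\mathcal{L}(G)$ is contained in $\mathcal{A}_{\mathbf{L}}$ if and only if $\hat{x}_k=\hat{x}_{k'}$ whenever $\lambda_k=\lambda_{k'}$. Furthermore, $$\mathcal{A}_{\mathbf{L}}=\mathrm{span}\{f_{\mathbb{1}},\mathbf{L}f_{\mathbb{1}},\ldots,\mathbf{L}^{r-1}f_{\mathbb{1}}\}.$$
   Context: Let $G$ be a graph with vertex set $V=\{v_1,\dots,v_n\}$ and a symmetric, entrywise non-negative weighted adjacency matrix $\mathbf{A}\in\mathbb{R}^{n\times n}$. The degree matrix $\mathbf{D}$ is diagonal with $\mathbf{D}_{ii}=\sum_k\mathbf{A}_{ik}$ (assumed positive), and the normalized graph Laplacian is $\mathbf{L}=\mathbf{I}_n-\mathbf{D}^{-1/2}\mathbf{A}\mathbf{D}^{-1/2}$. Signals $x:V\to\mathbb{R}$ are identified with vectors in $\mathbb{R}^n$; $\mathcal{L}(G)$ denotes this space. Fix an orthonormal eigendecomposition $\mathbf{L}=\mathbf{U}\,\mathrm{diag}(\lambda_1,\dots,\lambda_n)\,\mathbf{U}^\intercal$ with $\lambda_1\le\dots\le\lambda_n$, where the columns $u_1,\dots,u_n$ of the orthogonal matrix $\mathbf{U}$ are eigenvectors. The graph Fourier transform is $\hat{x}=\mathbf{U}^\intercal x$, i.e. $\hat{x}_k=u_k^\intercal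 x$. The graph convolution is $x\ast y=\mathbf{U}\,\mathrm{diag}(\hat{x})\,\mathbf{U}^\intercal y$; it makes $\mathcal{L}(G)$ a commutative associative algebra with unit $f_{\mathbb{1}}=\sum_{k=1}^n u_k$. Define $\mathcal{A}_{\mathbf{L}}=\mathrm{span}\{f_{\mathbb{1}},\mathbf{L}f_{\mathbb{1}},\mathbf{L}^2 f_{\mathbb{1}},\dots,\mathbf{L}^{n-1}f_{\mathbb{1}}\}$. *)

theory Defs
  imports "HOL-Analysis.Analysis"
begin

text \<open>Signals on the vertex set are vectors in real^'n (vertices = elements of the finite type 'n).\<close>

definition diag_mat :: "('n::finite \<Rightarrow> real) \<Rightarrow> real^'n^'n" where
  "diag_mat d = (\<chi> i j. if i = j then d i else 0)"

definition degree :: "real^'n^'n \<Rightarrow> 'n::finite \<Rightarrow> real" where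
  "degree A i = (\<Sum>k\<in>UNIV. A $ i $ k)"

definition norm_laplacian :: "real^'n^'n \<Rightarrow> real^'n::finite^'n" where
  "norm_laplacian A = mat 1 - diag_mat (\<lambda>i. 1 / sqrt (degree A i)) ** A ** diag_mat (\<lambda>i. 1 / sqrt (degree A i))"

fun matpow :: "real^'n^'n \<Rightarrow> nat \<Rightarrow> real^'n::finite^'n" where
  "matpow M 0 = mat 1"
| "matpow M (Suc k) = M ** matpow M k"

text \<open>Graph Fourier transform w.r.t. the orthogonal eigenvector matrix U.\<close>
definition gft :: "real^'n^'n \<Rightarrow> real^'n \<Rightarrow> real^'n::finite" where
  "gft U x = transpose U *v x"

definition graph_conv :: "real^'n^'n \<Rightarrow> real^'n \<Rightarrow> real^'n \<Rightarrow> real^'n::finite" where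
  "graph_conv U x y = (U ** diag_mat (\<lambda>k. gft U x $ k) ** transpose U) *v y"

definition conv_unit :: "real^'n^'n \<Rightarrow> real^'n::finite" where
  "conv_unit U = (\<Sum>k\<in>UNIV. column k U)"

definition krylov_span :: "real^'n^'n \<Rightarrow> real^'n \<Rightarrow> nat \<Rightarrow> (real^'n::finite) set" where
  "krylov_span L f m = span {matpow L i *v f | i. i < m}"

definition A_L :: "real^'n^'n \<Rightarrow> real^'n^'n \<Rightarrow> (real^'n::finite) set" where
  "A_L L U = krylov_span L (conv_unit U) CARD('n)"

text \<open>Subalgebra of (L(G), +, *): a linear subspace closed under graph convolution,
  containing the unit.\<close>
definition is_conv_subalgebra :: "real^'n^'n \<Rightarrow> (real^'n::finite) set \<Rightarrow> bool" where
  "is_conv_subalgebra U S \<longleftrightarrow> subspace S \<and> conv_unit U \<in> S \<and>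
     (\<forall>x\<in>S. \<forall>y\<in>S. graph_conv U x y \<in> S)"

end

theory Submission
  imports Defs
begin

text \<open>Conjugation by the orthogonal matrix \<open>U\<close> turns \<open>L\<^sup>i f\<^sub>1\<close> into \<open>U\<close> applied to the
  vector \<open>(\<lambda>\<^sub>k\<^sup>i)\<^sub>k\<close>, and turns graph convolution into componentwise multiplication. So
  everything reduces to the spectral domain, where the span of the first \<open>m\<close> powers of the
  vector \<open>\<Lambda> = (\<lambda>\<^sub>k)\<^sub>k\<close> is contained in the space of vectors that are constant on the level
  sets of \<open>\<lambda>\<close>. Once \<open>m \<ge> r\<close> the two spaces coincide, because Lagrange interpolation
  polynomials in \<open>\<Lambda>\<close> produce the indicator vector of every level set; these \<open>r\<close>
  indicators form a basis of the level-constant vectors, which are visibly closed under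
  componentwise multiplication.\<close>

lemma vector_power_component: "(x ^ i) $ k = (x $ k) ^ i" for x :: "'a::monoid_mult^'n"
  by (induction i) (simp_all add: one_vec_def)

lemma vector_prod_component: "(\<Prod>a\<in>F. f a) $ k = (\<Prod>a\<in>F. f a $ k)"
  for f :: "'b \<Rightarrow> 'a::comm_monoid_mult^'n"
  by (induction F rule: infinite_finite_induct) (simp_all add: one_vec_def)

definition level_constant :: "('n::finite \<Rightarrow> 'b) \<Rightarrow> (real^'n) set" where
  "level_constant lam = {v. \<forall>k k'. lam k = lam k' \<longrightarrow> v $ k = v $ k'}"

definition level_indicator :: "('n::finite \<Rightarrow> 'b) \<Rightarrow> 'b \<Rightarrow> real^'n" where
  "level_indicator lam \<mu> = (\<chi> k. if lam k = \<mu> then 1 else 0)"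

lemma level_constantI: "(\<And>k k'. lam k = lam k' \<Longrightarrow> v $ k = v $ k') \<Longrightarrow> v \<in> level_constant lam"
  unfolding level_constant_def by blast

lemma level_constantD: "v \<in> level_constant lam \<Longrightarrow> lam k = lam k' \<Longrightarrow> v $ k = v $ k'"
  unfolding level_constant_def by blast

lemma level_constant_componentwise:
  assumes "v \<in> level_constant lam" and "w \<in> level_constant lam"
  shows "(\<chi> k. f (v $ k) (w $ k)) \<in> level_constant lam"
proof (rule level_constantI)
  fix k k' assume eq: "lam k = lam k'"
  have "v $ k = v $ k'" and "w $ k = w $ k'"
    using level_constantD[OF assms(1) eq] level_constantD[OF assms(2) eq] .
  then show "(\<chi> k. f (v $ k) (w $ k)) $ k = (\<chi> k. f (v $ k) (w $ k)) $ k'"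
    by simp
qed

lemma subspace_level_constant: "subspace (level_constant lam)"
  unfolding subspace_def plus_vec_def scaleR_vec_def
  by (auto intro: level_constant_componentwise level_constantI)

lemma one_in_level_constant: "1 \<in> level_constant lam"
  by (rule level_constantI) (simp add: one_vec_def)

lemma mult_in_level_constant:
  "v \<in> level_constant lam \<Longrightarrow> w \<in> level_constant lam \<Longrightarrow> v * w \<in> level_constant lam"
  unfolding times_vec_def by (rule level_constant_componentwise)

lemma level_indicator_in_level_constant: "level_indicator lam \<mu> \<in> level_constant lam"
  by (simp add: level_constant_def level_indicator_def)

lemma level_constant_eq_span_level_indicators:
  "level_constant lam = span (level_indicator lam ` range lam)"
proof (rule span_subspace[symmetric])
  show "level_indicator lam ` range lam \<subseteq> level_constant lam"
    by (rule image_subsetI) (rule level_indicator_in_level_constant)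
  show "subspace (level_constant lam)"
    by (rule subspace_level_constant)
  show "level_constant lam \<subseteq> span (level_indicator lam ` range lam)"
  proof
    fix v assume v: "v \<in> level_constant lam"
    have "v = (\<Sum>\<mu>\<in>range lam. v $ inv lam \<mu> *\<^sub>R level_indicator lam \<mu>)"
    proof (subst vec_eq_iff, intro allI)
      fix k
      have "v $ inv lam (lam k) = v $ k"
        using v f_inv_into_f[of "lam k" lam UNIV] unfolding level_constant_def by blast
      then show "v $ k = (\<Sum>\<mu>\<in>range lam. v $ inv lam \<mu> *\<^sub>R level_indicator lam \<mu>) $ k"
        by (simp add: sum_component level_indicator_def if_distrib if_distribR cong: if_cong)
    qed
    also have "\<dots> \<in> span (level_indicator lam ` range lam)"
      by (intro span_sum span_scale span_base) blast
    finally show "v \<in> span (level_indicator lam ` range lam)" .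
  qed
qed

lemma inj_on_level_indicator: "inj_on (level_indicator lam) (range lam)"
proof (rule inj_onI)
  fix a b assume "a \<in> range lam" and eq: "level_indicator lam a = level_indicator lam b"
  then obtain k where "lam k = a" by blast
  moreover have "level_indicator lam a $ k = level_indicator lam b $ k"
    using eq by simp
  ultimately show "a = b"
    by (simp add: level_indicator_def split: if_splits)
qed

lemma independent_level_indicators: "independent (level_indicator lam ` range lam)"
proof (rule pairwise_orthogonal_independent)
  show "pairwise orthogonal (level_indicator lam ` range lam)"
  proof (rule pairwise_imageI)
    fix a b :: 'b assume "a \<noteq> b"
    then show "orthogonal (level_indicator lam a) (level_indicator lam b)"
      unfolding orthogonal_def inner_vec_def level_indicator_def by (intro sum.neutral) auto
  qed
  show "0 \<notin> level_indicator lam ` range lam"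
  proof
    assume "0 \<in> level_indicator lam ` range lam"
    then obtain k where "level_indicator lam (lam k) = 0"
      by (auto simp: image_iff)
    then have "level_indicator lam (lam k) $ k = 0"
      by simp
    then show False
      by (simp add: level_indicator_def)
  qed
qed

lemma dim_level_constant: "dim (level_constant lam) = card (range lam)"
  by (simp add: level_constant_eq_span_level_indicators dim_eq_card_independent
      independent_level_indicators card_image inj_on_level_indicator)

definition power_span :: "('n::finite \<Rightarrow> real) \<Rightarrow> nat \<Rightarrow> (real^'n) set" where
  "power_span lam m = span {(\<chi> k. lam k) ^ i | i. i < m}"

lemma power_span_mono: "m \<le> m' \<Longrightarrow> power_span lam m \<subseteq> power_span lam m'"
  unfolding power_span_def by (rule span_mono) auto

lemma power_span_subset_level_constant: "power_span lam m \<subseteq> level_constant lam"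
  unfolding power_span_def
  by (rule span_minimal[OF _ subspace_level_constant])
     (auto simp: level_constant_def vector_power_component)

lemma mult_in_power_span:
  assumes "v \<in> power_span lam m"
  shows "(\<chi> k. lam k) * v \<in> power_span lam (Suc m)"
proof -
  let ?\<Lambda> = "\<chi> k. lam k"
  have "linear (\<lambda>v. ?\<Lambda> * v)"
    by (rule linearI) (simp_all add: algebra_simps)
  then have "(\<lambda>v. ?\<Lambda> * v) ` power_span lam m = span ((\<lambda>v. ?\<Lambda> * v) ` {?\<Lambda> ^ i | i. i < m})"
    unfolding power_span_def by (simp add: linear_span_image)
  also have "\<dots> \<subseteq> power_span lam (Suc m)"
    unfolding power_span_def by (rule span_mono) (auto simp flip: power_Suc)
  finally show ?thesis
    using assms by blast
qed

lemma prod_shifts_in_power_span: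
  "finite F \<Longrightarrow> (\<Prod>\<nu>\<in>F. (\<chi> k. lam k) - \<nu> *\<^sub>R 1) \<in> power_span lam (Suc (card F))"
proof (induction F rule: finite_induct)
  case empty
  show ?case
    unfolding power_span_def by (rule span_base) force
next
  case (insert a F)
  let ?P = "\<Prod>\<nu>\<in>F. (\<chi> k. lam k) - \<nu> *\<^sub>R 1"
  have "?P \<in> power_span lam (Suc (card (insert a F)))"
    using insert power_span_mono[of "Suc (card F)" "Suc (card (insert a F))" lam] by auto
  moreover have "(\<chi> k. lam k) * ?P \<in> power_span lam (Suc (card (insert a F)))"
    using mult_in_power_span[OF insert.IH] insert.hyps by simp
  ultimately have "(\<chi> k. lam k) * ?P - a *\<^sub>R ?P \<in> power_span lam (Suc (card (insert a F)))"
    unfolding power_span_def by (intro span_diff span_scale)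
  then show ?case
    using insert.hyps by (simp add: left_diff_distrib)
qed

text \<open>The witness is the Lagrange polynomial of \<open>\<mu>\<close> on the eigenvalues, evaluated at \<open>\<Lambda>\<close>.\<close>

lemma level_indicator_in_power_span:
  assumes "\<mu> \<in> range lam"
  shows "level_indicator lam \<mu> \<in> power_span lam (card (range lam))"
proof -
  let ?F = "range lam - {\<mu>}"
  define c where "c = (\<Prod>\<nu>\<in>?F. \<mu> - \<nu>)"
  have "c \<noteq> 0"
    by (simp add: c_def)
  have "level_indicator lam \<mu> = (1 / c) *\<^sub>R (\<Prod>\<nu>\<in>?F. (\<chi> k. lam k) - \<nu> *\<^sub>R 1)"
  proof (subst vec_eq_iff, intro allI)
    fix k
    have "(\<Prod>\<nu>\<in>?F. lam k - \<nu>) = (if lam k = \<mu> then c else 0)"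
      by (auto simp: c_def)
    then show "level_indicator lam \<mu> $ k = ((1 / c) *\<^sub>R (\<Prod>\<nu>\<in>?F. (\<chi> k. lam k) - \<nu> *\<^sub>R 1)) $ k"
      using \<open>c \<noteq> 0\<close> by (simp add: level_indicator_def vector_prod_component one_vec_def)
  qed
  moreover have "Suc (card ?F) = card (range lam)"
    using assms by (simp add: card_Diff_singleton card_gt_0_iff)
  ultimately show ?thesis
    using prod_shifts_in_power_span[of ?F lam] unfolding power_span_def
    by (simp add: span_scale)
qed

lemma power_span_eq_level_constant:
  assumes "card (range lam) \<le> m"
  shows "power_span lam m = level_constant lam"
proof
  show "power_span lam m \<subseteq> level_constant lam"
    by (rule power_span_subset_level_constant)
  have "level_indicator lam ` range lam \<subseteq> power_span lam m"
    using level_indicator_in_power_span power_span_mono[OF assms] by blast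
  then show "level_constant lam \<subseteq> power_span lam m"
    unfolding level_constant_eq_span_level_indicators
    by (rule span_minimal) (simp add: power_span_def)
qed

lemma diag_mat_mult_vector: "diag_mat d *v v = (\<chi> k. d k) * v"
proof -
  have "(\<Sum>j\<in>UNIV. (if i = j then d i else 0) * v $ j) = (\<Sum>j\<in>UNIV. if j = i then d i * v $ i else 0)"
    for i by (rule sum.cong) auto
  then show ?thesis
    by (simp add: diag_mat_def matrix_vector_mult_def vec_eq_iff)
qed

lemma gft_matrix_vector_mult:
  assumes "orthogonal_matrix U"
  shows "gft U (U *v v) = v"
proof -
  have "gft U (U *v v) = (transpose U ** U) *v v"
    by (simp only: gft_def matrix_vector_mul_assoc)
  also have "\<dots> = v"
    using assms by (simp add: orthogonal_matrix_def)
  finally show ?thesis .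
qed

lemma matrix_vector_mult_gft:
  assumes "orthogonal_matrix U"
  shows "U *v gft U x = x"
proof -
  have "U *v gft U x = (U ** transpose U) *v x"
    by (simp only: gft_def matrix_vector_mul_assoc)
  also have "\<dots> = x"
    using assms by (simp add: orthogonal_matrix_def)
  finally show ?thesis .
qed

lemma orthogonal_diag_mult_vector:
  assumes "orthogonal_matrix U"
  shows "(U ** diag_mat lam ** transpose U) *v (U *v v) = U *v ((\<chi> k. lam k) * v)"
  by (simp only: gft_matrix_vector_mult[OF assms] diag_mat_mult_vector
      flip: matrix_vector_mul_assoc gft_def)

lemma matpow_orthogonal_diag_mult_vector:
  assumes "orthogonal_matrix U"
  shows "matpow (U ** diag_mat lam ** transpose U) i *v (U *v v) = U *v ((\<chi> k. lam k) ^ i * v)"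
proof (induction i)
  case 0
  show ?case
    by simp
next
  case (Suc i)
  have "matpow (U ** diag_mat lam ** transpose U) (Suc i) *v (U *v v)
      = (U ** diag_mat lam ** transpose U) *v (U *v ((\<chi> k. lam k) ^ i * v))"
    by (simp only: matpow.simps Suc.IH flip: matrix_vector_mul_assoc)
  also have "\<dots> = U *v ((\<chi> k. lam k) ^ Suc i * v)"
    by (simp only: orthogonal_diag_mult_vector[OF assms] power_Suc mult.assoc)
  finally show ?case .
qed

lemma conv_unit_eq: "conv_unit U = U *v 1"
  by (simp add: conv_unit_def matrix_vector_mult_def vec_eq_iff column_def sum_component one_vec_def)

lemma matpow_mult_conv_unit:
  assumes "orthogonal_matrix U"
  shows "matpow (U ** diag_mat lam ** transpose U) i *v conv_unit U = U *v (\<chi> k. lam k) ^ i"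
  using matpow_orthogonal_diag_mult_vector[OF assms, of lam i 1] by (simp add: conv_unit_eq)

lemma graph_conv_eq_mult_gft:
  assumes "orthogonal_matrix U"
  shows "graph_conv U x y = U *v (gft U x * gft U y)"
proof -
  have "graph_conv U x y = (U ** diag_mat (\<lambda>k. gft U x $ k) ** transpose U) *v (U *v gft U y)"
    unfolding graph_conv_def matrix_vector_mult_gft[OF assms] ..
  also have "\<dots> = U *v ((\<chi> k. gft U x $ k) * gft U y)"
    by (rule orthogonal_diag_mult_vector[OF assms])
  finally show ?thesis
    by simp
qed

lemma krylov_span_conv_unit:
  assumes "orthogonal_matrix U"
  shows "krylov_span (U ** diag_mat lam ** transpose U) (conv_unit U) m = (*v) U ` power_span lam m"
proof -
  have "{matpow (U ** diag_mat lam ** transpose U) i *v conv_unit U | i. i < m}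
      = (*v) U ` {(\<chi> k. lam k) ^ i | i. i < m}"
    by (auto simp: matpow_mult_conv_unit[OF assms])
  then show ?thesis
    unfolding krylov_span_def power_span_def
    using linear_span_image[OF matrix_vector_mul_linear[of U]] by simp
qed

lemma mem_orthogonal_image_iff:
  fixes U :: "real^'n^'n"
  assumes "orthogonal_matrix U"
  shows "x \<in> (*v) U ` S \<longleftrightarrow> gft U x \<in> S"
proof
  assume "x \<in> (*v) U ` S"
  then obtain v where "v \<in> S" and "x = U *v v"
    by blast
  then show "gft U x \<in> S"
    by (simp add: gft_matrix_vector_mult[OF assms])
next
  assume "gft U x \<in> S"
  then have "U *v gft U x \<in> (*v) U ` S"
    by (rule imageI)
  then show "x \<in> (*v) U ` S"
    by (simp only: matrix_vector_mult_gft[OF assms])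
qed

lemma dim_orthogonal_image:
  fixes U :: "real^'n^'n"
  assumes "orthogonal_matrix U"
  shows "dim ((*v) U ` S) = dim S"
proof (rule dim_image_eq)
  show "linear ((*v) U)"
    by (rule matrix_vector_mul_linear)
  show "inj_on ((*v) U) (span S)"
    by (rule inj_on_inverseI[where g = "gft U"]) (rule gft_matrix_vector_mult[OF assms])
qed

lemma is_conv_subalgebra_level_constant:
  assumes "orthogonal_matrix U"
  shows "is_conv_subalgebra U ((*v) U ` level_constant lam)"
  unfolding is_conv_subalgebra_def
proof (intro conjI ballI)
  show "subspace ((*v) U ` level_constant lam)"
    by (rule linear_subspace_image[OF matrix_vector_mul_linear subspace_level_constant])
  show "conv_unit U \<in> (*v) U ` level_constant lam"
    unfolding conv_unit_eq by (rule imageI) (rule one_in_level_constant)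
  fix x y assume "x \<in> (*v) U ` level_constant lam" and "y \<in> (*v) U ` level_constant lam"
  then have "gft U x * gft U y \<in> level_constant lam"
    by (simp add: mem_orthogonal_image_iff[OF assms] mult_in_level_constant)
  then show "graph_conv U x y \<in> (*v) U ` level_constant lam"
    unfolding graph_conv_eq_mult_gft[OF assms] by (rule imageI)
qed

theorem proposition1:
  fixes A U :: "real^('n::{finite,linorder})^('n::{finite,linorder})"
    and lam :: "('n::{finite,linorder}) \<Rightarrow> real"
    and r :: nat
  assumes sym: "transpose A = A"
    and nonneg: "\<forall>i j. 0 \<le> A $ i $ j"
    and deg_pos: "\<forall>i. 0 < degree A i"
    and orth: "orthogonal_matrix U"
    and eig: "norm_laplacian A = U ** diag_mat lam ** transpose U"
    and sorted: "\<forall>i j. i \<le> j \<longrightarrow> lam i \<le> lam j"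
    and r_def: "card (range lam) = r"
  shows "is_conv_subalgebra U (A_L (norm_laplacian A) U)
      \<and> dim (A_L (norm_laplacian A) U) = r
      \<and> (\<forall>x. x \<in> A_L (norm_laplacian A) U \<longleftrightarrow>
            (\<forall>k k'. lam k = lam k' \<longrightarrow> gft U x $ k = gft U x $ k'))
      \<and> A_L (norm_laplacian A) U = krylov_span (norm_laplacian A) (conv_unit U) r"
proof -
  let ?S = "(*v) U ` level_constant lam"
  have krylov_eq: "krylov_span (norm_laplacian A) (conv_unit U) m = ?S" if "r \<le> m" for m
    using that r_def by (simp add: eig krylov_span_conv_unit[OF orth] power_span_eq_level_constant)
  have "r \<le> CARD('n)"
    using r_def card_image_le[of UNIV lam] by simp
  then have A_L_eq: "A_L (norm_laplacian A) U = ?S"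
    unfolding A_L_def by (rule krylov_eq)
  have "dim ?S = r"
    by (simp only: dim_orthogonal_image[OF orth] dim_level_constant r_def)
  moreover have "x \<in> ?S \<longleftrightarrow> (\<forall>k k'. lam k = lam k' \<longrightarrow> gft U x $ k = gft U x $ k')" for x
    unfolding mem_orthogonal_image_iff[OF orth] level_constant_def by simp
  ultimately show ?thesis
    unfolding A_L_eq krylov_eq[OF order_refl] using is_conv_subalgebra_level_constant[OF orth]
    by blast
qed

end
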